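(* Let $k$ be a positive integer and let $M=(S,r)$ be a matroid which is $k$-tensor-compatible with the uniform matroid $U_{2,3}$. Then $M$ is $k$-modular extendable.
   Context: "Matroid" means a matroid on a finite ground set, written as (ground set, rank function). $U_{2,3}$ is the rank-$2$ uniform matroid on three elements. A matroid $P=(S_1\times S_2,r)$ is a tensor product of $M_1=(S_1,r_1)$ and $M_2=(S_2,r_2)$ if $r(X\times Y)=r_1(X)\cdot r_2(Y)$ for all $X\subseteq S_1$, $Y\subseteq S_2$; the set of all tensor products is denoted $M_1\otimes M_2$. For matroids $M,N$ let $T_1(M,N)=M\otimes N$ and $T_k(M,N)=\bigcup_{M'\in T_{k-1}(M,N)}M'\otimes N$ for $k\ge 2$. $M$ is $k$-tensor-compatible with $N$ if $T_k(M,N)\neq\emptyset$. For a matroid $M=(S,r)$ and $A,B\subseteq S$, a one-step extension of $M$ with respect to $A$ and $B$ is a matroid $M'=(S',r')$ with $S\subseteq S'$, $r'(X)=r(X)$ for all $X\subseteq S$, for which there is $Z\subseteq S'$ with $r'(A\cup Z)=r(A)$, $r'(B\cup Z)=r(B)$ and $r'(Z)=r(A)+r(B)-r(A\cup B)$. Every matroid is $0$-modular extendable. For $k\ge 1$, $M$ is $k$-modular extendable if for all $A,B\subseteq S$ there is a one-step extension of $M$ with respect to $A$ and $B$ that is $(k-1)$-modular extendable. *)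

theory Defs
  imports Main "HOL-Library.Infinite_Typeclass"
begin

text \<open>
  A matroid is a pair of a ground set and a rank function. Only the values of the rank function
  on subsets of the ground set are meaningful; all notions below refer to these values alone.
\<close>

type_synonym 'a matroid = "'a set \<times> ('a set \<Rightarrow> nat)"

fun is_matroid :: "'a matroid \<Rightarrow> bool" where
  "is_matroid (S, r) \<longleftrightarrow>
     finite S \<and>
     (\<forall>X. X \<subseteq> S \<longrightarrow> r X \<le> card X) \<and>
     (\<forall>X Y. X \<subseteq> Y \<and> Y \<subseteq> S \<longrightarrow> r X \<le> r Y) \<and>
     (\<forall>X Y. X \<subseteq> S \<and> Y \<subseteq> S \<longrightarrow> r (X \<union> Y) + r (X \<inter> Y) \<le> r X + r Y)"

fun is_uniform :: "nat \<Rightarrow> nat \<Rightarrow> 'a matroid \<Rightarrow> bool" where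
  "is_uniform d n (S, r) \<longleftrightarrow>
     finite S \<and> card S = n \<and> (\<forall>X. X \<subseteq> S \<longrightarrow> r X = min d (card X))"

definition tensor_products :: "'a matroid \<Rightarrow> 'b matroid \<Rightarrow> ('a \<times> 'b) matroid set"
    (infixl \<open>\<otimes>\<^sub>M\<close> 70) where
  "M\<^sub>1 \<otimes>\<^sub>M M\<^sub>2 = {(S, r). is_matroid (S, r) \<and> S = fst M\<^sub>1 \<times> fst M\<^sub>2 \<and>
     (\<forall>X Y. X \<subseteq> fst M\<^sub>1 \<and> Y \<subseteq> fst M\<^sub>2 \<longrightarrow> r (X \<times> Y) = snd M\<^sub>1 X * snd M\<^sub>2 Y)}"

text \<open>Transport of a matroid along a map that is injective on the ground set.\<close>

fun relabel :: "('a \<Rightarrow> 'b) \<Rightarrow> 'a matroid \<Rightarrow> 'b matroid" where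
  "relabel f (S, r) = (f ` S, \<lambda>X. r (f -` X \<inter> S))"

text \<open>
  The ground set \<open>(\<dots>((S \<times> E) \<times> E) \<dots>) \<times> E\<close> of a \<open>k\<close>-fold tensor product has a type that depends on
  \<open>k\<close>. To have a single type for all \<open>k\<close>, its element \<open>(\<dots>((x, y\<^sub>1), y\<^sub>2), \<dots>, y\<^sub>k)\<close> is renamed to
  \<open>(x, [y\<^sub>1, \<dots>, y\<^sub>k])\<close>. The iterates start at \<open>k = 1\<close>; the value at \<open>0\<close> is a dummy.
\<close>

fun iterated_tensor_products ::
    "nat \<Rightarrow> 'a matroid \<Rightarrow> 'b matroid \<Rightarrow> ('a \<times> 'b list) matroid set" where
  "iterated_tensor_products 0 M N = {}"
| "iterated_tensor_products (Suc 0) M N = relabel (\<lambda>(x, y). (x, [y])) ` (M \<otimes>\<^sub>M N)"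
| "iterated_tensor_products (Suc (Suc k)) M N =
     (\<Union>M' \<in> iterated_tensor_products (Suc k) M N.
        relabel (\<lambda>((x, ys), y). (x, ys @ [y])) ` (M' \<otimes>\<^sub>M N))"

definition tensor_compatible :: "nat \<Rightarrow> 'a matroid \<Rightarrow> 'b matroid \<Rightarrow> bool" where
  "tensor_compatible k M N \<longleftrightarrow> iterated_tensor_products k M N \<noteq> {}"

text \<open>The condition on the rank of \<open>Z\<close> is \<open>r' Z = r A + r B - r (A \<union> B)\<close>, without subtraction.\<close>

fun one_step_extension :: "'a matroid \<Rightarrow> 'a set \<Rightarrow> 'a set \<Rightarrow> 'a matroid \<Rightarrow> bool" where
  "one_step_extension (S, r) A B (S', r') \<longleftrightarrow>
     is_matroid (S', r') \<and> S \<subseteq> S' \<and> (\<forall>X. X \<subseteq> S \<longrightarrow> r' X = r X) \<and>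
     (\<exists>Z. Z \<subseteq> S' \<and> r' (A \<union> Z) = r A \<and> r' (B \<union> Z) = r B \<and> r' Z + r (A \<union> B) = r A + r B)"

text \<open>
  The type of ground elements has to be infinite, so that it always has room for the new elements
  of an extension. As ground sets are finite, every infinite type contains a copy of every
  extension of a given matroid, so the choice of the type does not matter.
\<close>

fun modular_extendable :: "nat \<Rightarrow> 'a::infinite matroid \<Rightarrow> bool" where
  "modular_extendable 0 M \<longleftrightarrow> True"
| "modular_extendable (Suc k) M \<longleftrightarrow>
     (\<forall>A B. A \<subseteq> fst M \<and> B \<subseteq> fst M \<longrightarrow>
        (\<exists>M'. one_step_extension M A B M' \<and> modular_extendable k M'))"

end

theory Submission imports Defs begin

text \<open>
  The argument is modelled on linear algebra. If \<open>M\<close> is a family of vectors of \<open>V\<close> and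
  \<open>N\<close> is represented by vectors \<open>a\<close>, \<open>b\<close>, \<open>c = a + b\<close> in a plane \<open>W\<close>, then a quotient of
  \<open>V \<otimes> W\<close> by a complement of \<open>V \<otimes> a\<close> is given by a linear map \<open>\<phi>\<close> on \<open>V\<close>: the vector \<open>x \<otimes> a\<close> becomes
  \<open>x\<close>, the vector \<open>x \<otimes> b\<close> becomes \<open>\<phi> x\<close> and \<open>x \<otimes> c\<close> becomes \<open>x + \<phi> x\<close>. Given \<open>A\<close> and \<open>B\<close>, say with
  \<open>A \<union> B\<close> spanning \<open>V\<close>, choose a basis
  \<open>C \<subseteq> B\<close> of \<open>B\<close> relative to \<open>A\<close>, and let \<open>\<phi>\<close> vanish on \<open>A\<close> and be \<open>-1\<close> on \<open>C\<close>. In other words, contract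
  \<open>Q = A \<times> {b} \<union> C \<times> {c}\<close>. Then \<open>1 + \<phi>\<close> projects along \<open>C\<close>, so it sends the span of \<open>B\<close> onto its
  intersection with the span of \<open>A\<close>. Hence the elements \<open>B \<times> {c}\<close> of the quotient span exactly
  the intersection that a one-step extension of \<open>M\<close> has to provide.

  All of this survives for an arbitrary tensor product \<open>P\<close> of \<open>M\<close> and \<open>N\<close>
  (\<open>tensor_one_step_extension\<close>). The ranks involved follow by submodularity from
  \<open>tensor_rank_rectangle_union\<close>, which determines the rank of \<open>X \<times> Y \<union> Q \<times> E\<close> in any tensor
  product, and from the fact that any two elements of \<open>U\<^bsub>2,3\<^esub>\<close> span the third.

  It remains to iterate. The extension is a minor of \<open>P\<close>, up to renaming, and \<open>P\<close> is
  \<open>k\<close>-tensor-compatible if \<open>M\<close> is \<open>(k + 1)\<close>-tensor-compatible and \<open>k > 0\<close>: this is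
  the reading of an iterated
  product from its first factor instead of its last (\<open>tensor_compatible_Suc\<close>). Tensor
  compatibility passes to minors (\<open>tensor_compatible_parallel_minor\<close>), because contracting
  \<open>Q \<times> E\<close> in a tensor product of \<open>M\<close> and \<open>N\<close> leaves a tensor product of \<open>M/Q\<close> and \<open>N\<close>, by the same
  rank formula. So induction on \<open>k\<close> applies to the extension.
\<close>

section \<open>Rank functions\<close>

lemma matroid_rank_mono:
  assumes "is_matroid (S, r)" "Y \<subseteq> S" "X \<subseteq> Y"
  shows "r X \<le> r Y"
  using assms by auto

lemma matroid_rank_empty:
  assumes "is_matroid (S, r)"
  shows "r {} = 0"
proof -
  have "r {} \<le> card ({}::'a set)" using assms by (metis empty_subsetI is_matroid.simps)
  then show ?thesis by simp
qed

lemma matroid_rank_submodular: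
  assumes "is_matroid (S, r)" "X \<subseteq> S" "Y \<subseteq> S" "D \<subseteq> X \<inter> Y"
  shows "r (X \<union> Y) + r D \<le> r X + r Y"
proof -
  have "r (X \<union> Y) + r (X \<inter> Y) \<le> r X + r Y" using assms by auto
  moreover have "r D \<le> r (X \<inter> Y)"
    by (rule matroid_rank_mono[OF assms(1)]) (use assms in auto)
  ultimately show ?thesis by linarith
qed

lemma matroid_rank_subadditive:
  assumes "is_matroid (S, r)" "X \<subseteq> S" "Y \<subseteq> S"
  shows "r (X \<union> Y) \<le> r X + r Y"
  using matroid_rank_submodular[OF assms, of "{}"] by simp

text \<open>
  The rank-only form of the fact that equal closures of \<open>V\<close> and \<open>V'\<close> stay equal after adding \<open>U\<close>.
\<close>

lemma matroid_rank_spanning: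
  assumes m: "is_matroid (S, r)" and "U \<subseteq> S" "V' \<subseteq> S" "V \<subseteq> V'" "r V' = r V"
  shows "r (U \<union> V') = r (U \<union> V)"
proof -
  have "r ((U \<union> V) \<union> V') + r V \<le> r (U \<union> V) + r V'"
    by (rule matroid_rank_submodular[OF m]) (use assms in auto)
  moreover have "(U \<union> V) \<union> V' = U \<union> V'" using assms by auto
  moreover have "r (U \<union> V) \<le> r (U \<union> V')"
    by (rule matroid_rank_mono[OF m]) (use assms in auto)
  ultimately show ?thesis using assms by simp
qed

text \<open>
  Greedily, \<open>C\<close> takes an element of \<open>B\<close> whenever this raises the rank of \<open>A \<union> C\<close>. The rank of \<open>C\<close>
  itself, rather than its cardinality, is recorded, since tensor products only see ranks.
\<close>

lemma matroid_relative_basis: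
  assumes m: "is_matroid (S, r)" and "A \<subseteq> S" "B \<subseteq> S"
  obtains C where "C \<subseteq> B" "r (A \<union> C) = r (A \<union> B)" "r A + r C = r (A \<union> B)"
proof -
  have "finite B" using assms finite_subset by auto
  then have "\<exists>C\<subseteq>B. r (A \<union> C) = r (A \<union> B) \<and> r A + r C = r (A \<union> B)"
    using \<open>B \<subseteq> S\<close>
  proof (induction B)
    case empty
    then show ?case using matroid_rank_empty[OF m] by auto
  next
    case (insert b B)
    then obtain C where C: "C \<subseteq> B" "r (A \<union> C) = r (A \<union> B)" "r A + r C = r (A \<union> B)"
      by auto
    have "r ({b} \<union> (A \<union> B)) = r ({b} \<union> (A \<union> C))"
      by (rule matroid_rank_spanning[OF m]) (use insert.prems \<open>A \<subseteq> S\<close> C in auto)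
    then have span: "r (A \<union> insert b B) = r (A \<union> insert b C)" by simp
    show ?case
    proof (cases "r (A \<union> insert b C) = r (A \<union> C)")
      case True
      then show ?thesis using C span by (intro exI[of _ C]) auto
    next
      case False
      have CS: "insert b C \<subseteq> S" "C \<subseteq> S" using C insert.prems by auto
      have "r {b} \<le> card {b}" using m CS by (metis insert_subset empty_subsetI is_matroid.simps)
      then have b: "r {b} \<le> 1" by simp
      have "r (A \<union> C) \<le> r (A \<union> insert b C)"
        by (rule matroid_rank_mono[OF m]) (use CS \<open>A \<subseteq> S\<close> in auto)
      moreover have "r ({b} \<union> C) \<le> r {b} + r C"
        by (rule matroid_rank_subadditive[OF m]) (use CS in auto)
      moreover have "r (A \<union> insert b C) \<le> r A + r (insert b C)"
        by (rule matroid_rank_subadditive[OF m]) (use CS \<open>A \<subseteq> S\<close> in auto)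
      ultimately have "r A + r (insert b C) = r (A \<union> insert b C)"
        using False C b by simp
      then show ?thesis using C span by (intro exI[of _ "insert b C"]) auto
    qed
  qed
  then show thesis using that by blast
qed

lemma is_matroid_uniform:
  assumes "is_uniform d n N"
  shows "is_matroid N"
proof -
  obtain E s where eq: "N = (E, s)" by fastforce
  have fin: "finite E" and s: "\<And>X. X \<subseteq> E \<Longrightarrow> s X = min d (card X)"
    using assms eq by auto
  have "s X \<le> s Y" if XY: "X \<subseteq> Y" "Y \<subseteq> E" for X Y
  proof -
    have "card X \<le> card Y" using card_mono finite_subset XY fin by metis
    moreover have "X \<subseteq> E" using XY by blast
    ultimately show ?thesis using s XY by (simp add: min_def)
  qed
  moreover have "s (X \<union> Y) + s (X \<inter> Y) \<le> s X + s Y" if XY: "X \<subseteq> E" "Y \<subseteq> E" for X Y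
  proof -
    have f: "finite X" "finite Y" using XY fin finite_subset by auto
    have "card (X \<union> Y) + card (X \<inter> Y) = card X + card Y"
      using card_Un_Int[OF f] by simp
    moreover have "card (X \<inter> Y) \<le> card X" "card (X \<inter> Y) \<le> card Y"
      using f by (auto intro: card_mono)
    moreover have "X \<union> Y \<subseteq> E" "X \<inter> Y \<subseteq> E" using XY by auto
    ultimately show ?thesis using s XY by (simp add: min_def)
  qed
  moreover have "s X \<le> card X" if "X \<subseteq> E" for X using s[OF that] by simp
  ultimately show ?thesis using fin unfolding eq is_matroid.simps by blast
qed

section \<open>Minors up to parallel copies\<close>

text \<open>
  \<open>M'\<close> arises from the contraction of \<open>M\<close> by \<open>Q\<close> by pulling back along \<open>g\<close>. As \<open>g\<close> is any map,
  this covers restrictions, renamings and parallel copies of elements at once, so that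
  the bijective changes of type in iterated tensor products and the minors taken of
  them are instances of one transitive relation.
\<close>

definition parallel_minor :: "'a matroid \<Rightarrow> 'b matroid \<Rightarrow> bool" where
  "parallel_minor M' M \<longleftrightarrow> finite (fst M') \<and>
     (\<exists>g Q. g ` fst M' \<subseteq> fst M \<and> Q \<subseteq> fst M \<and>
        (\<forall>X \<subseteq> fst M'. snd M' X = snd M (g ` X \<union> Q) - snd M Q))"

lemma parallel_minorI:
  assumes "finite S'" "g ` S' \<subseteq> S" "Q \<subseteq> S"
    and "\<And>X. X \<subseteq> S' \<Longrightarrow> r' X = r (g ` X \<union> Q) - r Q"
  shows "parallel_minor (S', r') (S, r)"
  using assms unfolding parallel_minor_def by auto

lemma parallel_minorE:
  assumes "parallel_minor (S', r') (S, r)" "is_matroid (S, r)"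
  obtains g Q where "finite S'" "g ` S' \<subseteq> S" "Q \<subseteq> S"
    "\<And>X. X \<subseteq> S' \<Longrightarrow> r (g ` X \<union> Q) = r' X + r Q"
proof -
  obtain g Q where *: "finite S'" "g ` S' \<subseteq> S" "Q \<subseteq> S"
      "\<And>X. X \<subseteq> S' \<Longrightarrow> r' X = r (g ` X \<union> Q) - r Q"
    using assms(1) unfolding parallel_minor_def by auto
  have add: "r (g ` X \<union> Q) = r' X + r Q" if "X \<subseteq> S'" for X
  proof -
    have "r Q \<le> r (g ` X \<union> Q)"
      by (rule matroid_rank_mono[OF assms(2)]) (use *(2,3) that in blast)+
    then show ?thesis using *(4)[OF that] by simp
  qed
  show thesis by (rule that[OF *(1-3)]) (rule add)
qed

lemma is_matroid_parallel_minor: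
  assumes "parallel_minor M' M" "is_matroid M"
  shows "is_matroid M'"
proof -
  obtain S' r' S r where eq: "M' = (S', r')" "M = (S, r)" by fastforce
  have m: "is_matroid (S, r)" using assms eq by simp
  obtain g Q where g: "finite S'" "g ` S' \<subseteq> S" "Q \<subseteq> S"
      "\<And>X. X \<subseteq> S' \<Longrightarrow> r (g ` X \<union> Q) = r' X + r Q"
    using assms eq parallel_minorE by metis
  have "r' X \<le> card X" if X: "X \<subseteq> S'" for X
  proof -
    have "r (g ` X \<union> Q) \<le> r (g ` X) + r Q"
      by (rule matroid_rank_subadditive[OF m]) (use g(2,3) X in blast)+
    moreover have "r (g ` X) \<le> card (g ` X)"
      using m g X by (metis image_mono is_matroid.simps order_trans)
    moreover have "card (g ` X) \<le> card X"
      using g X finite_subset card_image_le by metis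
    ultimately show ?thesis using g(4)[OF X] by linarith
  qed
  moreover have "r' X \<le> r' Y" if XY: "X \<subseteq> Y" "Y \<subseteq> S'" for X Y
  proof -
    have "r (g ` X \<union> Q) \<le> r (g ` Y \<union> Q)"
      by (rule matroid_rank_mono[OF m]) (use g(2,3) XY in blast)+
    then show ?thesis using g(4) XY by (metis add_le_cancel_right order_trans)
  qed
  moreover have "r' (X \<union> Y) + r' (X \<inter> Y) \<le> r' X + r' Y" if XY: "X \<subseteq> S'" "Y \<subseteq> S'" for X Y
  proof -
    have "r ((g ` X \<union> Q) \<union> (g ` Y \<union> Q)) + r (g ` (X \<inter> Y) \<union> Q)
        \<le> r (g ` X \<union> Q) + r (g ` Y \<union> Q)"
      by (rule matroid_rank_submodular[OF m]) (use g(2,3) XY in blast)+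
    moreover have "(g ` X \<union> Q) \<union> (g ` Y \<union> Q) = g ` (X \<union> Y) \<union> Q" by auto
    moreover have "X \<union> Y \<subseteq> S'" "X \<inter> Y \<subseteq> S'" using XY by auto
    ultimately show ?thesis using g(4) XY by simp
  qed
  ultimately show ?thesis using g(1) by (simp add: eq)
qed

lemma parallel_minor_trans:
  assumes "parallel_minor M'' M'" "parallel_minor M' M" "is_matroid M"
  shows "parallel_minor M'' M"
proof -
  obtain S'' r'' S' r' S r where eq: "M'' = (S'', r'')" "M' = (S', r')" "M = (S, r)"
    by (metis prod.exhaust)
  obtain g Q where g: "finite S'" "g ` S' \<subseteq> S" "Q \<subseteq> S"
      "\<And>X. X \<subseteq> S' \<Longrightarrow> r (g ` X \<union> Q) = r' X + r Q"
    using assms eq parallel_minorE by metis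
  have "is_matroid M'" using assms is_matroid_parallel_minor by blast
  then obtain h R where h: "finite S''" "h ` S'' \<subseteq> S'" "R \<subseteq> S'"
      "\<And>X. X \<subseteq> S'' \<Longrightarrow> r' (h ` X \<union> R) = r'' X + r' R"
    using assms eq parallel_minorE by metis
  show ?thesis unfolding eq
  proof (rule parallel_minorI[where g = "g \<circ> h" and Q = "g ` R \<union> Q"])
    fix X assume X: "X \<subseteq> S''"
    then have "h ` X \<union> R \<subseteq> S'" using h(2,3) X by blast
    from g(4)[OF this] have "r (g ` h ` X \<union> g ` R \<union> Q) = r'' X + r' R + r Q"
      using h(4)[OF X] by (simp add: image_Un)
    moreover have "r (g ` R \<union> Q) = r' R + r Q" using g(4)[OF h(3)] .
    ultimately show "r'' X = r ((g \<circ> h) ` X \<union> (g ` R \<union> Q)) - r (g ` R \<union> Q)"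
      by (simp add: image_comp Un_assoc)
  next
    show "(g \<circ> h) ` S'' \<subseteq> S" "g ` R \<union> Q \<subseteq> S"
      unfolding image_comp[symmetric] using g(2,3) h(2,3) by blast+
  qed (rule h(1))
qed

lemma relabel_parallel_minor:
  assumes "is_matroid M" "inj_on f (fst M)"
  shows "parallel_minor (relabel f M) M"
proof -
  obtain S r where eq: "M = (S, r)" by fastforce
  have m: "is_matroid (S, r)" using assms eq by simp
  have inj: "inj_on f S" using assms eq by simp
  have "f -` X \<inter> S = inv_into S f ` X" if X: "X \<subseteq> f ` S" for X
  proof -
    obtain Y where Y: "Y \<subseteq> S" "X = f ` Y" using X by (auto simp: subset_image_iff)
    have "f -` (f ` Y) \<inter> S = Y" using Y(1) inj by (auto simp: inj_on_def)
    then show ?thesis using Y inj by (simp add: inv_into_image_cancel)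
  qed
  then show ?thesis unfolding eq relabel.simps
    using m matroid_rank_empty[OF m]
    by (intro parallel_minorI[where g = "inv_into S f" and Q = "{}"]) (auto simp: inv_into_into)
qed

lemma is_matroid_relabel:
  assumes "is_matroid M" "inj_on f (fst M)"
  shows "is_matroid (relabel f M)"
  using is_matroid_parallel_minor relabel_parallel_minor assms by blast

lemma parallel_minor_relabel:
  assumes "is_matroid M" "inj_on f (fst M)"
  shows "parallel_minor M (relabel f M)"
proof -
  obtain S r where eq: "M = (S, r)" by fastforce
  have m: "is_matroid (S, r)" using assms eq by simp
  have inj: "inj_on f S" using assms eq by simp
  have "f -` (f ` X) \<inter> S = X" if "X \<subseteq> S" for X
    using that inj by (auto simp: inj_on_def)
  then show ?thesis unfolding eq relabel.simps
    using m matroid_rank_empty[OF m]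
    by (intro parallel_minorI[where g = f and Q = "{}"]) auto
qed

section \<open>Tensor products\<close>

lemma tensor_productD:
  assumes "(T, \<rho>) \<in> (S, r) \<otimes>\<^sub>M (E, s)"
  shows "is_matroid (T, \<rho>)" "T = S \<times> E"
    "\<And>X Y. X \<subseteq> S \<Longrightarrow> Y \<subseteq> E \<Longrightarrow> \<rho> (X \<times> Y) = r X * s Y"
  using assms unfolding tensor_products_def by auto

lemma is_matroid_tensor_product: "P \<in> M \<otimes>\<^sub>M N \<Longrightarrow> is_matroid P"
  unfolding tensor_products_def by auto

text \<open>
  Tensor products are not unique, but the rank of \<open>X \<times> Y \<union> Q \<times> E\<close> is forced. One may take
  \<open>Q \<subseteq> X\<close>, and submodularity for the two rectangles, which meet in \<open>Q \<times> Y\<close>, gives the upper bound.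
  For the lower bound, let \<open>I\<close> be a basis of \<open>E\<close> relative to \<open>Y\<close>: adding the columns
  \<open>X \<times> I\<close>, of which \<open>Q \<times> I\<close> is already present, raises the rank by at most
  \<open>(r X - r Q) * s I\<close>, and leads to a set of full rank \<open>r X * s E\<close>.
\<close>

lemma tensor_rank_rectangle_union:
  assumes P: "(T, \<rho>) \<in> (S, r) \<otimes>\<^sub>M (E, s)"
    and m: "is_matroid (S, r)" and n: "is_matroid (E, s)"
    and X: "X \<subseteq> S" and Q: "Q \<subseteq> S" and Y: "Y \<subseteq> E"
  shows "\<rho> (X \<times> Y \<union> Q \<times> E) + r Q * s Y = r (X \<union> Q) * s Y + r Q * s E"
proof -
  note t = tensor_productD[OF P]
  \<comment> \<open>Enlarging the first rectangle by \<open>Q \<times> Y\<close> does not change the union.\<close>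
  define W where "W = X \<union> Q"
  have W: "W \<subseteq> S" "Q \<subseteq> W" using X Q W_def by auto
  define D where "D = X \<times> Y \<union> Q \<times> E"
  have D: "D = W \<times> Y \<union> Q \<times> E" using Y unfolding D_def W_def by auto
  have DT: "D \<subseteq> T" unfolding t(2) D using W Y Q by auto
  obtain I where I: "I \<subseteq> E" "s (Y \<union> I) = s (Y \<union> E)" "s Y + s I = s (Y \<union> E)"
    using matroid_relative_basis[OF n Y subset_refl] .
  have YE: "Y \<union> E = E" using Y by auto
  have "\<rho> D + \<rho> (Q \<times> Y) \<le> \<rho> (W \<times> Y) + \<rho> (Q \<times> E)"
    unfolding D by (rule matroid_rank_submodular[OF t(1)]) (use W Y Q in \<open>auto simp: t(2)\<close>)
  then have upper: "\<rho> D + r Q * s Y \<le> r W * s Y + r Q * s E"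
    using t(3) W Y Q by simp
  have "\<rho> (D \<union> W \<times> I) + \<rho> (Q \<times> I) \<le> \<rho> D + \<rho> (W \<times> I)"
    by (rule matroid_rank_submodular[OF t(1)]) (use W Y Q I in \<open>auto simp: t(2) D\<close>)
  moreover have "\<rho> (W \<times> (Y \<union> I)) \<le> \<rho> (D \<union> W \<times> I)"
    by (rule matroid_rank_mono[OF t(1)]) (use W Y Q I in \<open>auto simp: t(2) D\<close>)
  ultimately have "r W * s E + r Q * s I \<le> \<rho> D + r W * s I"
    using t(3) W Y Q I YE by simp
  moreover have "s E = s Y + s I" using I YE by simp
  ultimately have "r W * s Y + r Q * s E \<le> \<rho> D + r Q * s Y"
    by (simp add: algebra_simps)
  then show ?thesis using upper unfolding D_def W_def by linarith
qed

text \<open>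
  Contracting \<open>Q\<close> in \<open>M\<close> corresponds to contracting \<open>Q \<times> E\<close> in the tensor product. By the
  formula for \<open>X \<times> Y \<union> Q \<times> E\<close> the rank of \<open>X \<times> Y\<close> then becomes
  \<open>(r (X \<union> Q) - r Q) * s Y\<close>, as a tensor product with \<open>M/Q\<close> requires.
\<close>

lemma tensor_product_parallel_minor:
  assumes P: "P \<in> M \<otimes>\<^sub>M N" and m: "is_matroid M" and n: "is_matroid N"
    and minor: "parallel_minor M' M"
  obtains P' where "P' \<in> M' \<otimes>\<^sub>M N" "parallel_minor P' P"
proof -
  obtain T \<rho> S r E s S' r' where eq: "P = (T, \<rho>)" "M = (S, r)" "N = (E, s)" "M' = (S', r')"
    by (metis prod.exhaust)
  note t = tensor_productD[OF P[unfolded eq]]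
  have m': "is_matroid (S, r)" and n': "is_matroid (E, s)" using m n eq by auto
  obtain g Q where g: "finite S'" "g ` S' \<subseteq> S" "Q \<subseteq> S"
      "\<And>X. X \<subseteq> S' \<Longrightarrow> r (g ` X \<union> Q) = r' X + r Q"
    using parallel_minorE[OF minor[unfolded eq] m'] by metis
  define \<rho>' where "\<rho>' = (\<lambda>X. \<rho> (map_prod g id ` X \<union> Q \<times> E) - \<rho> (Q \<times> E))"
  have pm: "parallel_minor (S' \<times> E, \<rho>') (T, \<rho>)"
    by (rule parallel_minorI[where g = "map_prod g id" and Q = "Q \<times> E"])
      (use g n' in \<open>auto simp: t(2) \<rho>'_def\<close>)
  have "\<rho>' (X \<times> Y) = r' X * s Y" if XY: "X \<subseteq> S'" "Y \<subseteq> E" for X Y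
  proof -
    have "map_prod g id ` (X \<times> Y) = g ` X \<times> Y" by (simp add: map_prod_surj_on)
    moreover have "\<rho> (g ` X \<times> Y \<union> Q \<times> E) + r Q * s Y = r (g ` X \<union> Q) * s Y + r Q * s E"
      by (rule tensor_rank_rectangle_union[OF P[unfolded eq] m' n']) (use XY g in auto)
    moreover have "\<rho> (Q \<times> E) = r Q * s E" using t(3) g by simp
    ultimately show ?thesis unfolding \<rho>'_def using g(4)[OF XY(1)]
      by (simp add: algebra_simps)
  qed
  then have "(S' \<times> E, \<rho>') \<in> M' \<otimes>\<^sub>M N"
    using is_matroid_parallel_minor[OF pm t(1)] unfolding tensor_products_def eq by auto
  then show thesis using that pm eq by blast
qed

section \<open>Iterated tensor products\<close>

lemma inj_on_append_last: "inj_on (\<lambda>((x, ys), y). (x, ys @ [y])) A"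
  by (auto simp: inj_on_def)

lemma inj_on_singleton_list: "inj_on (\<lambda>(x, y). (x, [y])) A"
  by (auto simp: inj_on_def)

lemma is_matroid_iterated:
  "R \<in> iterated_tensor_products k M N \<Longrightarrow> is_matroid R"
proof (induction k M N rule: iterated_tensor_products.induct)
  case (2 M N)
  then obtain P where P: "P \<in> M \<otimes>\<^sub>M N" "R = relabel (\<lambda>(x, y). (x, [y])) P" by auto
  show ?case unfolding P(2)
    by (rule is_matroid_relabel[OF is_matroid_tensor_product[OF P(1)] inj_on_singleton_list])
next
  case (3 k M N)
  then obtain K P where P: "P \<in> K \<otimes>\<^sub>M N" "R = relabel (\<lambda>((x, ys), y). (x, ys @ [y])) P"
    by auto
  show ?case unfolding P(2)
    by (rule is_matroid_relabel[OF is_matroid_tensor_product[OF P(1)] inj_on_append_last])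
qed auto

text \<open>
  The induction step for iterated products: their definition renames each new product, and
  the two renamings \<open>f\<close> and \<open>h\<close> may differ in type.
\<close>

lemma relabelled_tensor_product_parallel_minor:
  assumes P: "P \<in> M \<otimes>\<^sub>M N" and "is_matroid M" "is_matroid N"
    and "parallel_minor M' M" and f: "\<And>A. inj_on f A" and h: "\<And>A. inj_on h A"
  obtains P' where "P' \<in> M' \<otimes>\<^sub>M N" "parallel_minor (relabel h P') (relabel f P)"
proof -
  obtain P' where P': "P' \<in> M' \<otimes>\<^sub>M N" "parallel_minor P' P"
    using tensor_product_parallel_minor assms by metis
  have mat: "is_matroid P" "is_matroid P'" "is_matroid (relabel f P)"
    using P P' is_matroid_tensor_product is_matroid_parallel_minor relabel_parallel_minor f
    by blast+
  have "parallel_minor (relabel h P') P"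
    using parallel_minor_trans relabel_parallel_minor P' mat h by blast
  then have "parallel_minor (relabel h P') (relabel f P)"
    using parallel_minor_trans parallel_minor_relabel mat f by blast
  then show thesis using that P' by blast
qed

text \<open>
  For the induction on \<open>k\<close> it is not enough that \<open>M'\<close> has a \<open>k\<close>-fold product \<open>R'\<close>: the next factor
  is transferred from \<open>R\<close> to \<open>R'\<close>, which requires \<open>R'\<close> to be a minor of \<open>R\<close>.
\<close>

lemma iterated_parallel_minor:
  assumes n: "is_matroid N" and m: "is_matroid M" and minor: "parallel_minor M' M"
  shows "R \<in> iterated_tensor_products k M N \<Longrightarrow>
    \<exists>R' \<in> iterated_tensor_products k M' N. parallel_minor R' R"
proof (induction k arbitrary: R rule: induct_nat_012)
  case 0
  then show ?case by simp
next
  case 1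
  then obtain P where P: "P \<in> M \<otimes>\<^sub>M N" "R = relabel (\<lambda>(x, y). (x, [y])) P" by auto
  obtain P' where "P' \<in> M' \<otimes>\<^sub>M N" "parallel_minor (relabel (\<lambda>(x, y). (x, [y])) P') R"
    unfolding P(2) by (rule relabelled_tensor_product_parallel_minor[OF P(1) m n minor
        inj_on_singleton_list inj_on_singleton_list])
  then show ?case by auto
next
  case (ge2 k)
  then obtain K P where K: "K \<in> iterated_tensor_products (Suc k) M N"
    and P: "P \<in> K \<otimes>\<^sub>M N" "R = relabel (\<lambda>((x, ys), y). (x, ys @ [y])) P" by auto
  obtain K' where K': "K' \<in> iterated_tensor_products (Suc k) M' N" "parallel_minor K' K"
    using ge2.IH K by blast
  obtain P' where "P' \<in> K' \<otimes>\<^sub>M N"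
      "parallel_minor (relabel (\<lambda>((x, ys), y). (x, ys @ [y])) P') R"
    unfolding P(2)
    by (rule relabelled_tensor_product_parallel_minor[OF P(1) is_matroid_iterated[OF K] n K'(2)
        inj_on_append_last inj_on_append_last])
  then show ?case using K'(1) by auto
qed

lemma tensor_compatible_parallel_minor:
  assumes "is_matroid N" "is_matroid M" "parallel_minor M' M" "tensor_compatible k M N"
  shows "tensor_compatible k M' N"
  using iterated_parallel_minor[OF assms(1-3)] assms(4)
  unfolding tensor_compatible_def by blast

text \<open>
  The definition adds factors on the right, whereas the induction over extensions consumes
  the innermost factor, the one next to \<open>M\<close>. The two readings give the same matroids up to a
  renaming of \<open>(x, y # ys)\<close> to \<open>((x, y), ys)\<close>; the weaker relation of being a minor suffices
  here, and spares following this renaming through the iteration.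
\<close>

lemma iterated_peel_first:
  assumes n: "is_matroid N"
  shows "R \<in> iterated_tensor_products (Suc (Suc k)) M N \<Longrightarrow>
    \<exists>P \<in> M \<otimes>\<^sub>M N. \<exists>R' \<in> iterated_tensor_products (Suc k) P N. parallel_minor R' R"
proof (induction k arbitrary: R)
  case 0
  then obtain P K where P: "P \<in> M \<otimes>\<^sub>M N"
    and K: "K \<in> relabel (\<lambda>(x, y). (x, [y])) P \<otimes>\<^sub>M N"
      "R = relabel (\<lambda>((x, ys), y). (x, ys @ [y])) K" by auto
  have mat: "is_matroid (relabel (\<lambda>(x, y). (x, [y])) P)"
    by (rule is_matroid_iterated[of _ "Suc 0" M N]) (use P in simp)
  have minor: "parallel_minor P (relabel (\<lambda>(x, y). (x, [y])) P)"
    using parallel_minor_relabel is_matroid_tensor_product P inj_on_singleton_list by blast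
  obtain K' where "K' \<in> P \<otimes>\<^sub>M N" "parallel_minor (relabel (\<lambda>(x, y). (x, [y])) K') R"
    unfolding K(2)
    by (rule relabelled_tensor_product_parallel_minor[OF K(1) mat n minor
        inj_on_append_last inj_on_singleton_list])
  then show ?case using P by auto
next
  case (Suc k)
  then obtain L K where L: "L \<in> iterated_tensor_products (Suc (Suc k)) M N"
    and K: "K \<in> L \<otimes>\<^sub>M N" "R = relabel (\<lambda>((x, ys), y). (x, ys @ [y])) K"
    unfolding iterated_tensor_products.simps(3)[of "Suc k"] by blast
  obtain P L' where P: "P \<in> M \<otimes>\<^sub>M N"
    and L': "L' \<in> iterated_tensor_products (Suc k) P N" "parallel_minor L' L"
    using Suc.IH[OF L] by blast
  obtain K' where "K' \<in> L' \<otimes>\<^sub>M N"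
      "parallel_minor (relabel (\<lambda>((x, ys), y). (x, ys @ [y])) K') R"
    unfolding K(2)
    by (rule relabelled_tensor_product_parallel_minor[OF K(1) is_matroid_iterated[OF L] n L'(2)
        inj_on_append_last inj_on_append_last])
  then show ?case using P L'(1) by auto
qed

lemma tensor_compatible_Suc:
  assumes "is_matroid N" "tensor_compatible (Suc k) M N"
  obtains P where "P \<in> M \<otimes>\<^sub>M N" "k > 0 \<Longrightarrow> tensor_compatible k P N"
proof (cases k)
  case 0
  then show ?thesis using assms that unfolding tensor_compatible_def by auto
next
  case (Suc j)
  then show ?thesis using assms that iterated_peel_first[OF assms(1), of _ j M]
    unfolding tensor_compatible_def by blast
qed

section \<open>The one-step extension inside a tensor product\<close>

text \<open>
  The extension contracts \<open>Q = A \<times> {b} \<union> C \<times> {c}\<close> and keeps \<open>S \<times> {a}\<close>, a copy of \<open>M\<close>, and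
  \<open>Z = B \<times> {c}\<close>. Writing \<open>\<sim>\<close> for spanning the same flat, the rank computations rest on
  \<open>X \<times> {x, y} \<sim> X \<times> E\<close> for \<open>x \<noteq> y\<close>, which turns the sets of the first two items into
  the form \<open>X \<times> {y} \<union> D \<times> E\<close>:
  \<^item> \<open>S \<times> {a} \<union> Q \<sim> S \<times> {a} \<union> (A \<union> C) \<times> E\<close>, so \<open>S \<times> {a}\<close> and \<open>Q\<close> are skew, and contracting \<open>Q\<close>
    changes no rank within \<open>S \<times> {a}\<close>;
  \<^item> \<open>A \<times> {a} \<union> Z \<union> Q \<sim> B \<times> {c} \<union> A \<times> E\<close> and \<open>B \<times> {a} \<union> Z \<union> Q \<sim> A \<times> {b} \<union> B \<times> E\<close>, so \<open>Z\<close> lies in the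
    closures of \<open>A\<close> and \<open>B\<close> in the contraction;
  \<^item> \<open>Z \<union> Q = A \<times> {b} \<union> B \<times> {c}\<close>, in which the two columns are skew.
\<close>

lemma tensor_one_step_extension:
  fixes M :: "'a::infinite matroid" and N :: "'b matroid"
  assumes P: "P \<in> M \<otimes>\<^sub>M N" and m: "is_matroid M" and n: "is_uniform 2 3 N"
    and A: "A \<subseteq> fst M" and B: "B \<subseteq> fst M"
  obtains M' where "one_step_extension M A B M'" "parallel_minor M' P"
proof -
  obtain T \<rho> S r E s where eq: "P = (T, \<rho>)" "M = (S, r)" "N = (E, s)"
    by (metis prod.exhaust)
  note t = tensor_productD[OF P[unfolded eq]]
  have m': "is_matroid (S, r)" using m eq by auto
  have n': "is_matroid (E, s)" using is_matroid_uniform[OF n] eq by simp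
  note rect = tensor_rank_rectangle_union[OF P[unfolded eq] m' n']
  have A: "A \<subseteq> S" and B: "B \<subseteq> S" using A B eq by auto
  have "card E = 3" and s: "\<And>X. X \<subseteq> E \<Longrightarrow> s X = min 2 (card X)" using n eq by auto
  then obtain a b c where E: "E = {a, b, c}" and ne: "a \<noteq> b" "a \<noteq> c" "b \<noteq> c"
    by (metis card_3_iff)
  have s1: "s {y} = 1" if "y \<in> E" for y using s[of "{y}"] that by simp
  have s2: "s {x, y} = 2" if "x \<in> E" "y \<in> E" "x \<noteq> y" for x y
    using s[of "{x, y}"] that by simp
  have sE: "s E = 2" using s[of E] \<open>card E = 3\<close> by simp
  have col: "\<rho> (X \<times> {y}) = r X" if "X \<subseteq> S" "y \<in> E" for X y
    using t(3) that s1 by simp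
  have full: "\<rho> (X \<times> {y} \<union> Q \<times> E) = r (X \<union> Q) + r Q"
    if "X \<subseteq> S" "Q \<subseteq> S" "y \<in> E" for X Q y
    using rect[of X Q "{y}"] that s1 sE by simp
  have line: "\<rho> (U \<union> X \<times> {x} \<union> X \<times> {y}) = \<rho> (U \<union> X \<times> E)"
    if X: "X \<subseteq> S" and xy: "x \<in> E" "y \<in> E" "x \<noteq> y" and U: "U \<subseteq> T" for U X x y
  proof -
    have "\<rho> (U \<union> X \<times> E) = \<rho> (U \<union> X \<times> {x, y})"
      by (rule matroid_rank_spanning[OF t(1)]) (use t X xy U s2 sE in auto)
    moreover have "U \<union> X \<times> {x} \<union> X \<times> {y} = U \<union> X \<times> {x, y}" by auto
    ultimately show ?thesis by simp
  qed
  obtain C where C: "C \<subseteq> B" "r (A \<union> C) = r (A \<union> B)" "r A + r C = r (A \<union> B)"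
    using matroid_relative_basis[OF m' A B] .
  have CS: "C \<subseteq> S" using C B by auto
  define Q where "Q = A \<times> {b} \<union> C \<times> {c}"
  have QT: "Q \<subseteq> T" unfolding Q_def t(2) using A CS E by auto
  have Q_le: "\<rho> Q \<le> r (A \<union> B)"
  proof -
    have "\<rho> Q \<le> \<rho> (A \<times> {b}) + \<rho> (C \<times> {c})" unfolding Q_def
      by (rule matroid_rank_subadditive[OF t(1)]) (use A CS E t(2) in auto)
    then show ?thesis using col A CS E C by simp
  qed
  have SQ: "\<rho> (S \<times> {a} \<union> Q) = r S + r (A \<union> B)"
  proof -
    \<comment> \<open>The column \<open>a\<close> completes \<open>A \<times> {b}\<close> to \<open>A \<times> E\<close> and \<open>C \<times> {c}\<close> to \<open>C \<times> E\<close>.\<close>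
    have "S \<times> {a} \<union> Q = (S \<times> {a} \<union> C \<times> {c}) \<union> A \<times> {a} \<union> A \<times> {b}"
      using A unfolding Q_def by auto
    then have "\<rho> (S \<times> {a} \<union> Q) = \<rho> ((S \<times> {a} \<union> C \<times> {c}) \<union> A \<times> E)"
      using line[OF A, of a b "S \<times> {a} \<union> C \<times> {c}"] ne CS E by (auto simp: t(2))
    also have "(S \<times> {a} \<union> C \<times> {c}) \<union> A \<times> E = (S \<times> {a} \<union> A \<times> E) \<union> C \<times> {a} \<union> C \<times> {c}"
      using CS by auto
    also have "\<rho> \<dots> = \<rho> ((S \<times> {a} \<union> A \<times> E) \<union> C \<times> E)"
      using line[OF CS, of a c "S \<times> {a} \<union> A \<times> E"] ne A E by (auto simp: t(2))
    also have "(S \<times> {a} \<union> A \<times> E) \<union> C \<times> E = S \<times> {a} \<union> (A \<union> C) \<times> E" by auto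
    also have "\<rho> \<dots> = r (S \<union> (A \<union> C)) + r (A \<union> C)"
      by (rule full) (use A CS E in auto)
    also have "S \<union> (A \<union> C) = S" using A CS by auto
    finally show ?thesis using C by simp
  qed
  have XQ: "\<rho> (X \<times> {a} \<union> Q) = r X + r (A \<union> B)" if X: "X \<subseteq> S" for X
  proof (rule antisym)
    have "\<rho> (X \<times> {a} \<union> Q) \<le> \<rho> (X \<times> {a}) + \<rho> Q"
      by (rule matroid_rank_subadditive[OF t(1)]) (use X E QT t(2) in auto)
    then show "\<rho> (X \<times> {a} \<union> Q) \<le> r X + r (A \<union> B)" using col X E Q_le by simp
  next
    \<comment> \<open>If \<open>X \<times> {a}\<close> and \<open>Q\<close> were not skew, then \<open>S \<times> {a}\<close> and \<open>Q\<close> would not be either.\<close>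
    have "\<rho> ((X \<times> {a} \<union> Q) \<union> S \<times> {a}) + \<rho> (X \<times> {a}) \<le> \<rho> (X \<times> {a} \<union> Q) + \<rho> (S \<times> {a})"
      by (rule matroid_rank_submodular[OF t(1)]) (use X E QT t(2) in auto)
    moreover have "(X \<times> {a} \<union> Q) \<union> S \<times> {a} = S \<times> {a} \<union> Q" using X by auto
    ultimately show "r X + r (A \<union> B) \<le> \<rho> (X \<times> {a} \<union> Q)"
      using SQ col X E by simp
  qed
  have Q_rank: "\<rho> Q = r (A \<union> B)" using XQ[of "{}"] matroid_rank_empty[OF m'] by simp

  have AZ: "\<rho> (A \<times> {a} \<union> B \<times> {c} \<union> Q) = r A + r (A \<union> B)"
  proof -
    have "A \<times> {a} \<union> B \<times> {c} \<union> Q = B \<times> {c} \<union> A \<times> {a} \<union> A \<times> {b}"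
      using C unfolding Q_def by auto
    then have "\<rho> (A \<times> {a} \<union> B \<times> {c} \<union> Q) = \<rho> (B \<times> {c} \<union> A \<times> E)"
      using line[OF A, of a b "B \<times> {c}"] ne B E by (auto simp: t(2))
    then show ?thesis using full[of B A c] A B E by (simp add: Un_commute)
  qed
  have BZ: "\<rho> (B \<times> {a} \<union> B \<times> {c} \<union> Q) = r B + r (A \<union> B)"
  proof -
    have "B \<times> {a} \<union> B \<times> {c} \<union> Q = A \<times> {b} \<union> B \<times> {a} \<union> B \<times> {c}"
      using C unfolding Q_def by auto
    then have "\<rho> (B \<times> {a} \<union> B \<times> {c} \<union> Q) = \<rho> (A \<times> {b} \<union> B \<times> E)"
      using line[OF B, of a c "A \<times> {b}"] ne A E by (auto simp: t(2))
    then show ?thesis using full[of A B b] A B E by simp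
  qed
  have Z: "\<rho> (B \<times> {c} \<union> Q) = r A + r B"
  proof -
    have BQ: "B \<times> {c} \<union> Q = A \<times> {b} \<union> B \<times> {c}" using C unfolding Q_def by auto
    have "\<rho> (A \<times> {b} \<union> B \<times> {c}) \<le> \<rho> (A \<times> {b}) + \<rho> (B \<times> {c})"
      by (rule matroid_rank_subadditive[OF t(1)]) (use A B E t(2) in auto)
    \<comment> \<open>Enlarging the column \<open>A \<times> {b}\<close> to \<open>(A \<union> B) \<times> {b}\<close> makes \<open>B \<times> E\<close> available.\<close>
    moreover have "\<rho> ((A \<times> {b} \<union> B \<times> {c}) \<union> (A \<union> B) \<times> {b}) + \<rho> (A \<times> {b})
        \<le> \<rho> (A \<times> {b} \<union> B \<times> {c}) + \<rho> ((A \<union> B) \<times> {b})"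
      by (rule matroid_rank_submodular[OF t(1)]) (use A B E t(2) in auto)
    moreover have "\<rho> ((A \<times> {b} \<union> B \<times> {c}) \<union> (A \<union> B) \<times> {b}) = r (A \<union> B) + r B"
    proof -
      have "(A \<times> {b} \<union> B \<times> {c}) \<union> (A \<union> B) \<times> {b} = A \<times> {b} \<union> B \<times> {b} \<union> B \<times> {c}" by auto
      then show ?thesis using line[OF B, of b c "A \<times> {b}"] full[of A B b] ne A B E
        by (auto simp: t(2))
    qed
    ultimately show ?thesis using col A B E BQ by simp
  qed

  \<comment> \<open>The type of \<open>M\<close> has room for a copy \<open>Z\<close> of \<open>B \<times> {c}\<close> outside \<open>S\<close>.\<close>
  have finS: "finite S" using m' by simp
  then have "infinite (- S)" by (metis Compl_eq_Diff_UNIV Diff_infinite_finite infinite_UNIV)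
  then obtain Z where Zs: "Z \<subseteq> - S" "finite Z" "card Z = card B"
    using infinite_arbitrarily_large by metis
  have "finite B" using B finS finite_subset by blast
  then obtain h where h: "bij_betw h Z B" using Zs finite_same_card_bij by metis
  define g where "g = (\<lambda>x. if x \<in> S then (x, a) else (h x, c))"
  define r' where "r' = (\<lambda>X. \<rho> (g ` X \<union> Q) - \<rho> Q)"
  have gS: "g ` X = X \<times> {a}" if "X \<subseteq> S" for X using that unfolding g_def by auto
  have gZ: "g ` Z = B \<times> {c}"
  proof -
    have "g ` Z = (\<lambda>y. (y, c)) ` h ` Z"
      using Zs unfolding g_def by (auto simp: image_iff subset_iff)
    then show ?thesis using h by (auto simp: bij_betw_def)
  qed
  have pm: "parallel_minor (S \<union> Z, r') (T, \<rho>)"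
  proof (rule parallel_minorI[where g = g and Q = Q])
    show "g ` (S \<union> Z) \<subseteq> T" using gS[of S] gZ B E by (auto simp: image_Un t(2))
  qed (use finS Zs QT r'_def in auto)
  have "one_step_extension (S, r) A B (S \<union> Z, r')"
    unfolding one_step_extension.simps
  proof (intro conjI allI impI exI[of _ Z])
    show "is_matroid (S \<union> Z, r')" using is_matroid_parallel_minor pm t(1) by blast
    show "r' X = r X" if "X \<subseteq> S" for X
      using XQ[OF that] Q_rank gS[OF that] unfolding r'_def by simp
    show "r' (A \<union> Z) = r A"
      using AZ Q_rank gS[OF A] gZ unfolding r'_def by (simp add: image_Un)
    show "r' (B \<union> Z) = r B"
      using BZ Q_rank gS[OF B] gZ unfolding r'_def by (simp add: image_Un)
    have "\<rho> Q \<le> \<rho> (B \<times> {c} \<union> Q)"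
      by (rule matroid_rank_mono[OF t(1)]) (use B E QT t(2) in auto)
    then show "r' Z + r (A \<union> B) = r A + r B"
      using Z Q_rank gZ unfolding r'_def by simp
  qed auto
  then show thesis using that pm eq by blast
qed

theorem theorem5p5:
  fixes k :: nat and M :: "'a::infinite matroid" and N :: "'b matroid"
  assumes "k > 0"
    and "is_matroid M"
    and "is_uniform 2 3 N"
    and "tensor_compatible k M N"
  shows "modular_extendable k M"
  using assms
proof (induction k arbitrary: M)
  case 0
  then show ?case by simp
next
  case (Suc k)
  have n: "is_matroid N" using is_matroid_uniform Suc.prems by blast
  obtain P where P: "P \<in> M \<otimes>\<^sub>M N" "k > 0 \<Longrightarrow> tensor_compatible k P N"
    using tensor_compatible_Suc n Suc.prems by blast
  have mP: "is_matroid P" using P is_matroid_tensor_product by blast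
  have "\<exists>M'. one_step_extension M A B M' \<and> modular_extendable k M'"
    if AB: "A \<subseteq> fst M" "B \<subseteq> fst M" for A B
  proof -
    obtain M' where M': "one_step_extension M A B M'" "parallel_minor M' P"
      using tensor_one_step_extension P(1) Suc.prems AB by metis
    have "modular_extendable k M'"
    proof (cases "k = 0")
      case False
      then show ?thesis
        using Suc.IH Suc.prems(3) P(2) M'(2) mP n is_matroid_parallel_minor
          tensor_compatible_parallel_minor by blast
    qed simp
    then show ?thesis using M' by blast
  qed
  then show ?case by simp
qed

end
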